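(* Let $\mathcal U$ be a simplicial vector space and let $\mathcal V$ be a $\mathsf{VS}$ $n$-groupoid. Then the internal hom $\underline{\mathrm{Hom}}(\mathcal U,\mathcal V)$ is a $\mathsf{VS}$ $n$-groupoid.
   Context: Vector spaces are finite-dimensional over $\mathbb R$; a simplicial vector space $\mathcal V$ is a simplicial object in vector spaces, with faces $d_i$ and degeneracies $s_j$. $\mathsf{SVec}$ denotes the category of simplicial vector spaces, and $\mathsf{SVec}(\cdot,\cdot)$ its (vector space of) morphisms. Horns: for $m\ge 1$, $0\le k\le m$, $\Lambda^m_k(\mathcal V)$ is the space of tuples $(x_0,\dots,\widehat{x_k},\dots,x_m)$ in $\mathcal V_{m-1}$ with $d_ix_j=d_{j-1}x_i$ for all $i<j$, $i,j\neq k$; the horn projection is $p^m_k:\mathcal V_m\to\Lambda^m_k(\mathcal V)$, $x\mapsto(d_ix)_{i\ne k}$. For $n\in\mathbb Z_{\ge 0}\cup\{\infty\}$, a $\mathsf{VS}$ $n$-groupoid is a simplicial vector space such that $p^m_k$ is surjective for all $m\ge1$, $0\le k\le m$, and bijective for all $m\ge n+1$, $0\le k\le m$. Internal hom: $\Delta[m]_l$ is the set of order-preserving maps $[l]\to[m]$. For a simplicial set $K$, $(\mathcal V\otimes K)_l=\bigoplus_{u\in K_l}\mathcal V_l^u$ (copies of $\mathcal V_l$ indexed by $u$) with faces and degeneracies $d_i(v^u)=(d_iv)^{d_iu}$, $s_i(v^u)=(s_iv)^{s_iu}$. Then $\underline{\mathrm{Hom}}(\mathcal U,\mathcal V)_m=\mathsf{SVec}(\mathcal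 U\otimes\Delta[m],\mathcal V)$, with faces and degeneracies given by precomposition with the coface and codegeneracy maps between the $\Delta[m]$'s.
   Formalization: For n = ∞ the internal hom is only claimed to be a simplicial vector space with surjective horn projections, its levels possibly infinite-dimensional, since finite-dimensionality can fail there; for finite n finite-dimensionality of the levels is included. *)

theory Defs
  imports
    "HOL-Analysis.Analysis"
    "HOL-Library.Function_Algebras"
    "HOL-Analysis.Finite_Function_Topology"
    "HOL-Library.Extended_Nat"
    "HOL-Library.FuncSet"
begin

instantiation "fun" :: (type, real_vector) real_vector
begin

definition scaleR_fun :: "real \<Rightarrow> ('a \<Rightarrow> 'b) \<Rightarrow> 'a \<Rightarrow> 'b" where
  "scaleR_fun c f = (\<lambda>x. c *\<^sub>R f x)"

instance
  by standard (simp_all add: scaleR_fun_def plus_fun_def fun_eq_iff algebra_simps)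

end

text \<open>
  The sets of simplices of all levels are carriers inside one ambient type.
  \<open>face X m i\<close> is \<open>d\<^sub>i : X\<^sub>m \<rightarrow> X\<^sub>m\<^sub>-\<^sub>1\<close> (relevant for \<open>m \<ge> 1\<close>, \<open>i \<le> m\<close>) and
  \<open>degen X m j\<close> is \<open>s\<^sub>j : X\<^sub>m \<rightarrow> X\<^sub>m\<^sub>+\<^sub>1\<close> (relevant for \<open>j \<le> m\<close>); their values at other
  indices, or off the carriers, are irrelevant.
\<close>

record 'a simplicial =
  level :: "nat \<Rightarrow> 'a set"
  face :: "nat \<Rightarrow> nat \<Rightarrow> 'a \<Rightarrow> 'a"
  degen :: "nat \<Rightarrow> nat \<Rightarrow> 'a \<Rightarrow> 'a"

definition simplicial_set :: "'a simplicial \<Rightarrow> bool" where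
  "simplicial_set X \<longleftrightarrow>
     (\<forall>m\<ge>1. \<forall>i\<le>m. face X m i \<in> level X m \<rightarrow> level X (m - 1)) \<and>
     (\<forall>m. \<forall>j\<le>m. degen X m j \<in> level X m \<rightarrow> level X (m + 1)) \<and>
     (\<forall>m\<ge>2. \<forall>j\<le>m. \<forall>i<j. \<forall>x\<in>level X m.
        face X (m - 1) i (face X m j x) = face X (m - 1) (j - 1) (face X m i x)) \<and>
     (\<forall>m. \<forall>j\<le>m. \<forall>i\<le>j. \<forall>x\<in>level X m.
        degen X (m + 1) i (degen X m j x) = degen X (m + 1) (j + 1) (degen X m i x)) \<and>
     (\<forall>m\<ge>1. \<forall>j\<le>m. \<forall>i<j. \<forall>x\<in>level X m.
        face X (m + 1) i (degen X m j x) = degen X (m - 1) (j - 1) (face X m i x)) \<and>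
     (\<forall>m. \<forall>j\<le>m. \<forall>x\<in>level X m.
        face X (m + 1) j (degen X m j x) = x \<and> face X (m + 1) (j + 1) (degen X m j x) = x) \<and>
     (\<forall>m\<ge>1. \<forall>j\<le>m. \<forall>i\<le>m + 1. j + 1 < i \<longrightarrow> (\<forall>x\<in>level X m.
        face X (m + 1) i (degen X m j x) = degen X (m - 1) j (face X m (i - 1) x)))"

definition linear_betw :: "'a::real_vector set \<Rightarrow> 'b::real_vector set \<Rightarrow> ('a \<Rightarrow> 'b) \<Rightarrow> bool" where
  "linear_betw A B f \<longleftrightarrow> f \<in> A \<rightarrow> B \<and>
     (\<forall>x\<in>A. \<forall>y\<in>A. f (x + y) = f x + f y) \<and> (\<forall>c. \<forall>x\<in>A. f (c *\<^sub>R x) = c *\<^sub>R f x)"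

text \<open>No dimension condition is imposed here; it is the separate predicate
  \<open>levelwise_finite_dim\<close>. The reason is that morphisms between levelwise finite-dimensional
  simplicial vector spaces can form an infinite-dimensional space, for instance the endomorphisms
  of the object that corresponds under Dold-Kan to the complex with one copy of the
  reals in every degree and zero differential.\<close>

definition simplicial_vector_space :: "'a::real_vector simplicial \<Rightarrow> bool" where
  "simplicial_vector_space V \<longleftrightarrow> simplicial_set V \<and>
     (\<forall>m. subspace (level V m)) \<and>
     (\<forall>m\<ge>1. \<forall>i\<le>m. linear_betw (level V m) (level V (m - 1)) (face V m i)) \<and>
     (\<forall>m. \<forall>j\<le>m. linear_betw (level V m) (level V (m + 1)) (degen V m j))"

definition levelwise_finite_dim :: "'a::real_vector simplicial \<Rightarrow> bool" where
  "levelwise_finite_dim V \<longleftrightarrow> (\<forall>m. \<exists>B. finite B \<and> span B = level V m)"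

text \<open>A tuple \<open>(x\<^sub>0, \<dots>, x\<^sub>m)\<close> with \<open>x\<^sub>k\<close> omitted is an extensional function on
  \<open>{..m} - {k}\<close>.\<close>

definition horn :: "'a simplicial \<Rightarrow> nat \<Rightarrow> nat \<Rightarrow> (nat \<Rightarrow> 'a) set" where
  "horn V m k = {x \<in> ({..m} - {k}) \<rightarrow>\<^sub>E level V (m - 1).
     \<forall>i\<in>{..m} - {k}. \<forall>j\<in>{..m} - {k}. i < j \<longrightarrow>
       face V (m - 1) i (x j) = face V (m - 1) (j - 1) (x i)}"

definition horn_proj :: "'a simplicial \<Rightarrow> nat \<Rightarrow> nat \<Rightarrow> 'a \<Rightarrow> nat \<Rightarrow> 'a" where
  "horn_proj V m k x = (\<lambda>i\<in>{..m} - {k}. face V m i x)"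

definition VS_groupoid :: "enat \<Rightarrow> 'a::real_vector simplicial \<Rightarrow> bool" where
  "VS_groupoid n V \<longleftrightarrow> simplicial_vector_space V \<and>
     (\<forall>m\<ge>1. \<forall>k\<le>m. horn_proj V m k ` level V m = horn V m k) \<and>
     (\<forall>m. n + 1 \<le> enat m \<longrightarrow>
        (\<forall>k\<le>m. bij_betw (horn_proj V m k) (level V m) (horn V m k)))"

definition coface :: "nat \<Rightarrow> nat \<Rightarrow> nat" where
  "coface i a = (if a < i then a else a + 1)"

definition codegen :: "nat \<Rightarrow> nat \<Rightarrow> nat" where
  "codegen j a = (if a \<le> j then a else a - 1)"

definition std_simplex :: "nat \<Rightarrow> (nat \<Rightarrow> nat) simplicial" where
  "std_simplex m = \<lparr>
     level = (\<lambda>l. {u \<in> {..l} \<rightarrow>\<^sub>E {..m}. mono_on {..l} u}),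
     face = (\<lambda>l i u. compose {..l - 1} u (coface i)),
     degen = (\<lambda>l j u. compose {..l + 1} u (codegen j))\<rparr>"

text \<open>The direct sum of copies of \<open>A\<close> indexed by \<open>K\<close>, as finitely supported functions;
  \<open>v\<^sup>u\<close> is \<open>Poly_Mapping.single u v\<close>. The map \<open>sum_map \<phi> g\<close> is the additive extension of
  \<open>v\<^sup>u \<mapsto> (g v)\<^bsup>\<phi> u\<^esup>\<close>.\<close>

definition direct_sum :: "'k set \<Rightarrow> 'a::zero set \<Rightarrow> ('k \<Rightarrow>\<^sub>0 'a) set" where
  "direct_sum K A =
     {w. Poly_Mapping.keys w \<subseteq> K \<and> (\<forall>u\<in>K. Poly_Mapping.lookup w u \<in> A)}"

definition sum_map ::
    "('k \<Rightarrow> 'k2) \<Rightarrow> ('a::zero \<Rightarrow> 'b::comm_monoid_add) \<Rightarrow> ('k \<Rightarrow>\<^sub>0 'a) \<Rightarrow> ('k2 \<Rightarrow>\<^sub>0 'b)" where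
  "sum_map \<phi> g w =
     (\<Sum>u\<in>Poly_Mapping.keys w. Poly_Mapping.single (\<phi> u) (g (Poly_Mapping.lookup w u)))"

definition tensor ::
    "'a::real_vector simplicial \<Rightarrow> 'k simplicial \<Rightarrow> ('k \<Rightarrow>\<^sub>0 'a) simplicial" where
  "tensor V K = \<lparr>
     level = (\<lambda>l. direct_sum (level K l) (level V l)),
     face = (\<lambda>l i. sum_map (face K l i) (face V l i)),
     degen = (\<lambda>l j. sum_map (degen K l j) (degen V l j))\<rparr>"

text \<open>Morphisms are extended by zero off the carriers, so that each one has a unique
  representative and they form a subspace of the function type.\<close>

definition SVec ::
    "'a::real_vector simplicial \<Rightarrow> 'b::real_vector simplicial \<Rightarrow> (nat \<Rightarrow> 'a \<Rightarrow> 'b) set" where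
  "SVec U V = {f.
     (\<forall>l. linear_betw (level U l) (level V l) (f l)) \<and>
     (\<forall>l. \<forall>x. x \<notin> level U l \<longrightarrow> f l x = 0) \<and>
     (\<forall>l\<ge>1. \<forall>i\<le>l. \<forall>x\<in>level U l. f (l - 1) (face U l i x) = face V l i (f l x)) \<and>
     (\<forall>l. \<forall>j\<le>l. \<forall>x\<in>level U l. f (l + 1) (degen U l j x) = degen V l j (f l x))}"

text \<open>Precomposition of \<open>f : U \<otimes> \<Delta>[m] \<rightarrow> V\<close> with the map \<open>U \<otimes> \<Delta>[p] \<rightarrow> U \<otimes> \<Delta>[m]\<close> induced by
  an order-preserving \<open>\<theta> : [p] \<rightarrow> [m]\<close>, namely \<open>v\<^sup>u \<mapsto> v\<^bsup>\<theta> \<circ> u\<^esup>\<close>.\<close>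

definition precomp ::
    "'a::real_vector simplicial \<Rightarrow> nat \<Rightarrow> (nat \<Rightarrow> nat) \<Rightarrow>
     (nat \<Rightarrow> ((nat \<Rightarrow> nat) \<Rightarrow>\<^sub>0 'a) \<Rightarrow> 'b::real_vector) \<Rightarrow>
     (nat \<Rightarrow> ((nat \<Rightarrow> nat) \<Rightarrow>\<^sub>0 'a) \<Rightarrow> 'b)" where
  "precomp U p \<theta> f = (\<lambda>l w.
     if w \<in> level (tensor U (std_simplex p)) l
     then f l (sum_map (\<lambda>u. compose {..l} \<theta> u) (\<lambda>v. v) w) else 0)"

definition internal_hom ::
    "'a::real_vector simplicial \<Rightarrow> 'b::real_vector simplicial \<Rightarrow>
     (nat \<Rightarrow> ((nat \<Rightarrow> nat) \<Rightarrow>\<^sub>0 'a) \<Rightarrow> 'b) simplicial" where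
  "internal_hom U V = \<lparr>
     level = (\<lambda>m. SVec (tensor U (std_simplex m)) V),
     face = (\<lambda>m i. precomp U (m - 1) (coface i)),
     degen = (\<lambda>m j. precomp U (m + 1) (codegen j))\<rparr>"

end

theory Submission
  imports Defs
begin

text \<open>
  In a simplicial vector space every horn has a filler: Moore's construction corrects the faces of
  an arbitrary simplex one by one by adding degeneracies (\<open>horn_filler\<close>). The internal hom is a
  simplicial vector space, because precomposition is functorial in the order-preserving map and the
  cosimplicial identities hold between the cofaces and codegeneracies. So horn projections are
  onto, and for both \<open>V\<close> and the internal hom the groupoid condition says only that they have trivial
  kernel in every degree \<open>m \<ge> n + 1\<close> (\<open>VS_groupoid_iff_trivial_kernels\<close>).

  A morphism \<open>f : U \<otimes> \<Delta>[m] \<rightarrow> V\<close> in the kernel of the \<open>k\<close>-th horn projection is a morphism that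
  vanishes at \<open>x\<^sup>u\<close> whenever \<open>u\<close> misses some vertex other than \<open>k\<close>. Let \<open>m \<ge> n + 1\<close>. The value of
  \<open>f\<close> at \<open>y\<^bsup>id\<^esup>\<close> then lies in the kernel of the \<open>k\<close>-th horn projection of \<open>V\<close>, so it is zero; taking
  the \<open>k\<close>-th face, \<open>f\<close> vanishes also at \<open>x\<^sup>u\<close> for the coface \<open>u = \<delta>\<^sup>k\<close>. Together this covers all
  degrees below \<open>m\<close>. In degrees \<open>l \<ge> m\<close> a simplex of \<open>V\<close> with zero faces is zero, so \<open>f = 0\<close> by
  induction on the degree (\<open>internal_hom_trivial_kernel\<close>, \<open>SVec_eq_0_if_low_degrees_eq_0\<close>).

  The same induction shows, for finite \<open>n\<close>, that a morphism is determined by its values in degrees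
  up to \<open>n\<close>. These depend on finitely many real coordinates, whence finite dimension
  (\<open>internal_hom_levelwise_finite_dim\<close>).
\<close>

section \<open>Linear maps between carriers\<close>

lemma linear_betwI:
  assumes "\<And>x. x \<in> A \<Longrightarrow> f x \<in> B"
    and "\<And>x y. x \<in> A \<Longrightarrow> y \<in> A \<Longrightarrow> f (x + y) = f x + f y"
    and "\<And>c x. x \<in> A \<Longrightarrow> f (c *\<^sub>R x) = c *\<^sub>R f x"
  shows "linear_betw A B f"
  using assms unfolding linear_betw_def by auto

lemma linear_betw_mem: "linear_betw A B f \<Longrightarrow> x \<in> A \<Longrightarrow> f x \<in> B"
  unfolding linear_betw_def by auto

lemma linear_betw_add:
  "linear_betw A B f \<Longrightarrow> x \<in> A \<Longrightarrow> y \<in> A \<Longrightarrow> f (x + y) = f x + f y"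
  unfolding linear_betw_def by auto

lemma linear_betw_scale: "linear_betw A B f \<Longrightarrow> x \<in> A \<Longrightarrow> f (c *\<^sub>R x) = c *\<^sub>R f x"
  unfolding linear_betw_def by auto

lemma linear_betw_comp:
  assumes f: "linear_betw A B f" and g: "linear_betw B C g"
  shows "linear_betw A C (\<lambda>x. g (f x))"
  by (rule linear_betwI)
    (simp_all add: linear_betw_mem[OF f] linear_betw_mem[OF g] linear_betw_add[OF f]
      linear_betw_add[OF g] linear_betw_scale[OF f] linear_betw_scale[OF g])

lemma linear_betw_0:
  assumes "linear_betw A B f" and "subspace A"
  shows "f 0 = 0"
  using linear_betw_scale[OF assms(1) subspace_0[OF assms(2)], of 0] by simp

lemma linear_betw_diff:
  assumes "linear_betw A B f" and "subspace A" and "x \<in> A" and "y \<in> A"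
  shows "f (x - y) = f x - f y"
proof -
  have "f (x + (-1) *\<^sub>R y) = f x + (-1) *\<^sub>R f y"
    using assms by (simp only: linear_betw_add linear_betw_scale subspace_scale)
  then show ?thesis by simp
qed

lemma linear_betw_sum:
  assumes "linear_betw A B f" and "subspace A" and "\<And>i. i \<in> I \<Longrightarrow> x i \<in> A"
  shows "f (\<Sum>i\<in>I. x i) = (\<Sum>i\<in>I. f (x i))"
  using assms(3)
proof (induction I rule: infinite_finite_induct)
  case (insert i I)
  then show ?case
    by (simp add: linear_betw_add[OF assms(1)] subspace_sum[OF assms(2)])
qed (use linear_betw_0[OF assms(1,2)] in auto)

lemma linear_betw_eq_0_on_span:
  assumes f: "linear_betw (span B) T f" and z: "\<And>b. b \<in> B \<Longrightarrow> f b = 0" and x: "x \<in> span B"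
  shows "f x = 0"
proof -
  have "x \<in> span B \<and> f x = 0"
    using x
  proof (induction rule: span_induct_alt)
    case base
    then show ?case using linear_betw_0[OF f] span_zero by simp
  next
    case (step c b y)
    then have b: "c *\<^sub>R b \<in> span B" and y: "y \<in> span B" by (auto intro: span_base span_scale)
    then show ?case
      using step z[of b] linear_betw_add[OF f b y] linear_betw_scale[OF f span_base[of b], of c]
      by (simp add: span_add)
  qed
  then show ?thesis by blast
qed

text \<open>By induction on the set of functionals. If \<open>\<phi>\<^sub>i\<close> does not vanish at \<open>x \<in> S\<close>, then \<open>S\<close> is
  spanned by \<open>x\<close> and the kernel of \<open>\<phi>\<^sub>i\<close> in \<open>S\<close>, on which the remaining functionals still separate
  points; so the number of functionals bounds the dimension.\<close>

lemma finite_span_if_finite_separating_functionals: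
  fixes S :: "'a::real_vector set" and \<phi> :: "'i \<Rightarrow> 'a \<Rightarrow> real"
  assumes "finite I" and "subspace S" and "\<And>i. i \<in> I \<Longrightarrow> linear_betw S UNIV (\<phi> i)"
    and "\<And>x. x \<in> S \<Longrightarrow> (\<And>i. i \<in> I \<Longrightarrow> \<phi> i x = 0) \<Longrightarrow> x = 0"
  shows "\<exists>B. finite B \<and> span B = S"
  using assms
proof (induction I arbitrary: S rule: finite_induct)
  case empty
  then have "S = {0}" using subspace_0 by blast
  then show ?case by (intro exI[of _ "{}"]) simp
next
  case (insert i I)
  note S = insert.prems(1) and lin = insert.prems(2)[of i, simplified]
  define S' where "S' = {x \<in> S. \<phi> i x = 0}"
  have "subspace S'"
    unfolding S'_def using S lin
    by (auto simp: subspace_def linear_betw_add[OF lin] linear_betw_scale[OF lin] linear_betw_0[OF lin S])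
  moreover have "linear_betw S' UNIV (\<phi> j)" if "j \<in> I" for j
    using insert.prems(2)[of j] that unfolding linear_betw_def S'_def by auto
  ultimately obtain B where B: "finite B" "span B = S'"
    using insert.IH[of S'] insert.prems(3) unfolding S'_def by blast
  show ?case
  proof (cases "S' = S")
    case True
    then show ?thesis using B by blast
  next
    case False
    then obtain x where x: "x \<in> S" "\<phi> i x \<noteq> 0" unfolding S'_def by auto
    have "y \<in> span (insert x B)" if y: "y \<in> S" for y
    proof -
      define c where "c = \<phi> i y / \<phi> i x"
      have "\<phi> i (y - c *\<^sub>R x) = 0"
        using x y S by (simp add: linear_betw_diff[OF lin S] subspace_scale linear_betw_scale[OF lin] c_def)
      then have "y - c *\<^sub>R x \<in> S'"
        using x y S by (simp add: S'_def subspace_diff subspace_scale)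
      then show ?thesis
        using B(2) by (auto simp: span_insert)
    qed
    moreover have "span (insert x B) \<subseteq> S"
      using span_superset[of B] B(2) x(1) by (intro span_minimal[OF _ S]) (auto simp: S'_def)
    ultimately have "span (insert x B) = S" by auto
    then show ?thesis using B(1) by (metis finite_insert)
  qed
qed

lemma finite_coordinates:
  fixes B :: "'a::real_vector set"
  assumes "finite B"
  shows "\<exists>C (r :: 'a \<Rightarrow> 'a \<Rightarrow> real). finite C \<and> (\<forall>c\<in>C. linear_betw (span B) UNIV (r c)) \<and>
    (\<forall>x\<in>span B. (\<forall>c\<in>C. r c x = 0) \<longrightarrow> x = 0)"
proof -
  obtain C where C: "C \<subseteq> B" "independent C" "B \<subseteq> span C"
    using maximal_independent_subset[of B] by auto
  have sp: "span C = span B"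
    using C by (metis span_mono span_minimal subspace_span subset_antisym)
  show ?thesis
  proof (intro exI conjI ballI impI)
    show "finite C" using C(1) assms finite_subset by blast
    show "linear_betw (span B) UNIV (\<lambda>x. representation C x c)" for c
      by (rule linear_betwI)
        (auto simp: sp[symmetric] representation_add[OF C(2)] representation_scale[OF C(2)])
    show "x = 0" if "x \<in> span B" "\<forall>c\<in>C. representation C x c = 0" for x
    proof -
      have "representation C x c = 0" for c
        using that(2) representation_ne_zero by metis
      then have "(\<Sum>b | representation C x b \<noteq> 0. representation C x b *\<^sub>R b) = 0" by simp
      then show ?thesis
        using sum_nonzero_representation_eq[OF C(2), of x] that(1) sp by simp
    qed
  qed
qed

section \<open>Simplicial vector spaces\<close>

lemma svs_subspace: "simplicial_vector_space V \<Longrightarrow> subspace (level V m)"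
  unfolding simplicial_vector_space_def by blast

lemma svs_face_linear:
  "simplicial_vector_space V \<Longrightarrow> 1 \<le> m \<Longrightarrow> i \<le> m \<Longrightarrow>
    linear_betw (level V m) (level V (m - 1)) (face V m i)"
  unfolding simplicial_vector_space_def by blast

lemma svs_degen_linear:
  "simplicial_vector_space V \<Longrightarrow> j \<le> m \<Longrightarrow> linear_betw (level V m) (level V (m + 1)) (degen V m j)"
  unfolding simplicial_vector_space_def by blast

lemma svs_simplicial_set: "simplicial_vector_space V \<Longrightarrow> simplicial_set V"
  unfolding simplicial_vector_space_def by (rule conjunct1)

lemma svs_face_face:
  "simplicial_vector_space V \<Longrightarrow> 2 \<le> m \<Longrightarrow> j \<le> m \<Longrightarrow> i < j \<Longrightarrow> x \<in> level V m \<Longrightarrow>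
    face V (m - 1) i (face V m j x) = face V (m - 1) (j - 1) (face V m i x)"
  by (rule simplicial_set_def[THEN iffD1, THEN conjunct2, THEN conjunct2, THEN conjunct1,
        rule_format, OF svs_simplicial_set]; assumption)

lemma svs_face_degen_less:
  "simplicial_vector_space V \<Longrightarrow> 1 \<le> m \<Longrightarrow> j \<le> m \<Longrightarrow> i < j \<Longrightarrow> x \<in> level V m \<Longrightarrow>
    face V (m + 1) i (degen V m j x) = degen V (m - 1) (j - 1) (face V m i x)"
  by (rule simplicial_set_def[THEN iffD1, THEN conjunct2, THEN conjunct2, THEN conjunct2,
        THEN conjunct2, THEN conjunct1, rule_format, OF svs_simplicial_set]; assumption)

lemma svs_face_degen_same:
  assumes "simplicial_vector_space V" "j \<le> m" "x \<in> level V m"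
  shows "face V (m + 1) j (degen V m j x) = x" "face V (m + 1) (j + 1) (degen V m j x) = x"
  using simplicial_set_def[THEN iffD1, THEN conjunct2, THEN conjunct2, THEN conjunct2,
      THEN conjunct2, THEN conjunct2, THEN conjunct1, rule_format, OF svs_simplicial_set, OF assms]
  by simp_all

lemma svs_face_degen_greater:
  "simplicial_vector_space V \<Longrightarrow> 1 \<le> m \<Longrightarrow> j \<le> m \<Longrightarrow> i \<le> m + 1 \<Longrightarrow> j + 1 < i \<Longrightarrow>
    x \<in> level V m \<Longrightarrow> face V (m + 1) i (degen V m j x) = degen V (m - 1) j (face V m (i - 1) x)"
  by (rule simplicial_set_def[THEN iffD1, THEN conjunct2, THEN conjunct2, THEN conjunct2,
        THEN conjunct2, THEN conjunct2, THEN conjunct2, rule_format, OF svs_simplicial_set];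
      assumption)

lemma horn_proj_in_horn:
  assumes V: "simplicial_vector_space V" and m: "1 \<le> m" and k: "k \<le> m" and x: "x \<in> level V m"
  shows "horn_proj V m k x \<in> horn V m k"
proof -
  have "face V (m - 1) i (face V m j x) = face V (m - 1) (j - 1) (face V m i x)"
    if "i \<in> {..m} - {k}" "j \<in> {..m} - {k}" "i < j" for i j
    using that k by (intro svs_face_face[OF V _ _ _ x]) auto
  then show ?thesis
    unfolding horn_def horn_proj_def using linear_betw_mem[OF svs_face_linear[OF V m] x] by auto
qed

text \<open>Moore's filler. The faces are prescribed one at a time, first \<open>0, \<dots>, k - 1\<close> upwards, then
  \<open>m, \<dots>, k + 1\<close> downwards. To correct the \<open>r\<close>-th face of the current candidate \<open>w\<close>, add the
  degeneracy \<open>s\<^sub>r y\<close> (on the way up) or \<open>s\<^bsub>r-1\<^esub> y\<close> (on the way down) of the defect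
  \<open>y = x\<^sub>r - d\<^sub>r w\<close>. The horn equations make the faces of \<open>y\<close> vanish in all directions already
  treated, so by the simplicial identities this leaves the corrected faces unchanged.\<close>

lemma horn_filler:
  assumes V: "simplicial_vector_space V" and m: "1 \<le> m" and k: "k \<le> m" and x: "x \<in> horn V m k"
  shows "\<exists>w\<in>level V m. \<forall>i\<in>{..m} - {k}. face V m i w = x i"
proof -
  obtain p where p: "m = p + 1" using m by (metis le_add_diff_inverse2)
  note sub = svs_subspace[OF V]
  note fl = svs_face_linear[OF V m] and dl = svs_degen_linear[OF V, of _ p, folded p]
  have xl: "x i \<in> level V p" if "i \<le> m" "i \<noteq> k" for i
    using x that p unfolding horn_def by (auto simp: PiE_iff)
  have xx: "face V p i (x j) = face V p (j - 1) (x i)" if "i < j" "j \<le> m" "i \<noteq> k" "j \<noteq> k" for i j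
    using x that p unfolding horn_def by auto
  have ff: "face V p i (face V m j w) = face V p (j - 1) (face V m i w)"
    if "i < j" "j \<le> m" "w \<in> level V m" "1 \<le> p" for i j w
    using svs_face_face[OF V _ that(2,1,3)] that(4) p by simp
  have d0: "degen V (p - 1) j 0 = 0" if "j \<le> p - 1" for j
    using linear_betw_0[OF svs_degen_linear[OF V that] sub] .
  have fd: "face V p i (a - b) = face V p i a - face V p i b"
    if "1 \<le> p" "i \<le> p" "a \<in> level V p" "b \<in> level V p" for i a b
    using linear_betw_diff[OF svs_face_linear[OF V that(1,2)] sub that(3,4)] .
  have up: "\<exists>w\<in>level V m. \<forall>i<r. face V m i w = x i" if "r \<le> k" for r
    using that
  proof (induction r)
    case 0
    then show ?case using subspace_0[OF sub] by blast
  next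
    case (Suc r)
    then obtain w where w: "w \<in> level V m" and wi: "\<And>i. i < r \<Longrightarrow> face V m i w = x i" by auto
    have r: "r < k" "r \<le> p" using Suc.prems k p by auto
    define y where "y = x r - face V m r w"
    have fw: "face V m r w \<in> level V p"
      using linear_betw_mem[OF fl w] r k p by simp
    have y: "y \<in> level V p"
      using fw xl[of r] r k subspace_diff[OF sub] by (auto simp: y_def)
    have dy: "degen V p r y \<in> level V m" using linear_betw_mem[OF dl[OF r(2)] y] .
    have "face V m i (w + degen V p r y) = x i" if "i < Suc r" for i
    proof (cases "i = r")
      case True
      then show ?thesis
        using svs_face_degen_same(1)[OF V r(2) y] linear_betw_add[OF fl w dy, of r] r k p
        by (simp add: y_def)
    next
      case False
      then have i: "i < r" using that by simp
      have p1: "1 \<le> p" using i r by simp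
      have "face V p i y = face V p i (x r) - face V p i (face V m r w)"
        unfolding y_def using i r k p p1 fw xl[of r] by (intro fd) auto
      also have "\<dots> = face V p (r - 1) (x i) - face V p (r - 1) (face V m i w)"
        using i r k w p1 by (simp add: xx ff)
      finally have "face V p i y = 0" using wi[OF i] by simp
      then have "face V m i (degen V p r y) = 0"
        using svs_face_degen_less[OF V p1 r(2) i y] d0[of "r - 1"] r(2) p by simp
      then show ?thesis
        using wi[OF i] linear_betw_add[OF fl w dy, of i] i r k by simp
    qed
    then show ?case using subspace_add[OF sub w dy] by blast
  qed
  have down: "\<exists>w\<in>level V m. \<forall>i\<le>m. i < k \<or> m - q < i \<longrightarrow> face V m i w = x i" if "q \<le> m - k" for q
    using that
  proof (induction q)
    case 0
    then show ?case using up[of k] by auto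
  next
    case (Suc q)
    define r where "r = m - q"
    have r: "k < r" "r \<le> m" "r - 1 \<le> p" "r - 1 + 1 = r" "m - Suc q = r - 1"
      using Suc.prems p by (auto simp: r_def)
    obtain w where w: "w \<in> level V m"
      and wi: "\<And>i. i \<le> m \<Longrightarrow> i < k \<or> r < i \<Longrightarrow> face V m i w = x i"
      using Suc unfolding r_def by auto
    define y where "y = x r - face V m r w"
    have fw: "face V m r w \<in> level V p"
      using linear_betw_mem[OF fl w] r p by simp
    have y: "y \<in> level V p"
      using fw xl[of r] r subspace_diff[OF sub] by (auto simp: y_def)
    have dy: "degen V p (r - 1) y \<in> level V m" using linear_betw_mem[OF dl[OF r(3)] y] .
    have "face V m i (w + degen V p (r - 1) y) = x i" if im: "i \<le> m" and ir: "i < k \<or> r - 1 < i" for i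
    proof -
      consider (same) "i = r" | (above) "r < i" | (below) "i < k" using ir by linarith
      then show ?thesis
      proof cases
        case same
        then show ?thesis
          using svs_face_degen_same(2)[OF V r(3) y] linear_betw_add[OF fl w dy, of r] r p
          by (simp add: y_def)
      next
        case above
        have p1: "1 \<le> p" using above r im p by linarith
        have "face V p (i - 1) y = face V p (i - 1) (x r) - face V p (i - 1) (face V m r w)"
          unfolding y_def using above im r p p1 fw xl[of r] by (intro fd) auto
        also have "\<dots> = face V p r (x i) - face V p r (face V m i w)"
          using above im r w p1 by (simp add: xx[of r i] ff[of r i])
        finally have "face V p (i - 1) y = 0" using wi[OF im] above by simp
        then have "face V m i (degen V p (r - 1) y) = 0"
          using svs_face_degen_greater[OF V p1 r(3) _ _ y, of i] d0[of "r - 1"] above im r p by simp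
        then show ?thesis
          using wi[OF im] linear_betw_add[OF fl w dy, of i] above im by simp
      next
        case below
        have p1: "1 \<le> p" using below r im p by linarith
        have "face V p i y = face V p i (x r) - face V p i (face V m r w)"
          unfolding y_def using below im r p p1 fw xl[of r] by (intro fd) auto
        also have "\<dots> = face V p (r - 1) (x i) - face V p (r - 1) (face V m i w)"
          using below im r w p1 by (simp add: xx[of i r] ff[of i r])
        finally have "face V p i y = 0" using wi[OF im] below by simp
        then have "face V m i (degen V p (r - 1) y) = 0"
          using svs_face_degen_less[OF V p1 r(3) _ y, of i] d0[of "r - 1 - 1"] below im r p by simp
        then show ?thesis
          using wi[OF im] linear_betw_add[OF fl w dy, of i] below im by simp
      qed
    qed
    then show ?case unfolding r(5) using subspace_add[OF sub w dy] by blast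
  qed
  obtain w where w: "w \<in> level V m" "\<forall>i\<le>m. i < k \<or> m - (m - k) < i \<longrightarrow> face V m i w = x i"
    using down[of "m - k"] by blast
  have "face V m i w = x i" if "i \<in> {..m} - {k}" for i
    using that w(2) k by (cases "i < k") auto
  then show ?thesis using w(1) by blast
qed

lemma horn_proj_image:
  assumes V: "simplicial_vector_space V" and m: "1 \<le> m" and k: "k \<le> m"
  shows "horn_proj V m k ` level V m = horn V m k"
proof
  show "horn_proj V m k ` level V m \<subseteq> horn V m k"
    using horn_proj_in_horn[OF assms] by blast
  show "horn V m k \<subseteq> horn_proj V m k ` level V m"
  proof
    fix x assume x: "x \<in> horn V m k"
    then obtain w where w: "w \<in> level V m" "\<forall>i\<in>{..m} - {k}. face V m i w = x i"
      using horn_filler[OF assms] by blast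
    have "x = horn_proj V m k w"
      using x w(2) unfolding horn_def horn_proj_def by (auto simp: PiE_iff extensional_def fun_eq_iff)
    then show "x \<in> horn_proj V m k ` level V m" using w(1) by blast
  qed
qed

text \<open>For simplicial vector spaces the surjectivity half of the groupoid condition is automatic, and
  injectivity is a condition on kernels; this is the form in which the groupoid condition is checked
  and used below.\<close>

lemma VS_groupoid_iff_trivial_kernels:
  "VS_groupoid n V \<longleftrightarrow> simplicial_vector_space V \<and>
     (\<forall>m k x. n + 1 \<le> enat m \<longrightarrow> k \<le> m \<longrightarrow> x \<in> level V m \<longrightarrow>
        (\<forall>i\<le>m. i \<noteq> k \<longrightarrow> face V m i x = 0) \<longrightarrow> x = 0)"
    (is "_ \<longleftrightarrow> _ \<and> ?K")
proof (cases "simplicial_vector_space V")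
  case V: True
  note sub = svs_subspace[OF V]
  have m1: "1 \<le> m" if "n + 1 \<le> enat m" for m
    using that by (cases n) (auto simp: one_enat_def)
  show ?thesis
  proof
    assume G: "VS_groupoid n V"
    have "x = 0" if m: "n + 1 \<le> enat m" and k: "k \<le> m" and x: "x \<in> level V m"
      and z: "\<forall>i\<le>m. i \<noteq> k \<longrightarrow> face V m i x = 0" for m k x
    proof -
      have "inj_on (horn_proj V m k) (level V m)"
        using G m k unfolding VS_groupoid_def bij_betw_def by blast
      moreover have "horn_proj V m k x = horn_proj V m k 0"
        unfolding horn_proj_def
        using z linear_betw_0[OF svs_face_linear[OF V m1[OF m]] sub]
        by (auto simp: restrict_def fun_eq_iff)
      ultimately show ?thesis
        using x subspace_0[OF sub] by (auto dest: inj_onD)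
    qed
    then show "simplicial_vector_space V \<and> ?K" using V by blast
  next
    assume A: "simplicial_vector_space V \<and> ?K"
    have "bij_betw (horn_proj V m k) (level V m) (horn V m k)" if m: "n + 1 \<le> enat m" and k: "k \<le> m" for m k
    proof -
      have "inj_on (horn_proj V m k) (level V m)"
      proof (rule inj_onI)
        fix x y assume xy: "x \<in> level V m" "y \<in> level V m" "horn_proj V m k x = horn_proj V m k y"
        have "face V m i (x - y) = 0" if "i \<le> m" "i \<noteq> k" for i
        proof -
          have "face V m i x = face V m i y"
            using fun_cong[OF xy(3), of i] that unfolding horn_proj_def by simp
          then show ?thesis
            using linear_betw_diff[OF svs_face_linear[OF V m1[OF m] that(1)] sub xy(1,2)] by simp
        qed
        then have "x - y = 0"
          using A m k subspace_diff[OF sub xy(1,2)] by blast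
        then show "x = y" by simp
      qed
      then show ?thesis
        using horn_proj_image[OF V m1[OF m] k] unfolding bij_betw_def by blast
    qed
    then show "VS_groupoid n V"
      unfolding VS_groupoid_def using V horn_proj_image[OF V] by blast
  qed
qed (auto simp: VS_groupoid_def)

section \<open>Direct sums of copies of a vector space\<close>

lemma lookup_scaleR: "Poly_Mapping.lookup (c *\<^sub>R w) u = c *\<^sub>R Poly_Mapping.lookup w u"
  by (simp add: scaleR_poly_mapping_def)

lemma single_scaleR: "Poly_Mapping.single u (c *\<^sub>R x) = c *\<^sub>R Poly_Mapping.single u x"
  by (rule poly_mapping_eqI) (simp add: lookup_scaleR lookup_single when_def)

lemma direct_sum_lookup:
  assumes "subspace A" and "w \<in> direct_sum K A"
  shows "Poly_Mapping.lookup w u \<in> A"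
proof (cases "u \<in> K")
  case True
  then show ?thesis using assms(2) unfolding direct_sum_def by blast
next
  case False
  then have "Poly_Mapping.lookup w u = 0"
    using assms(2) unfolding direct_sum_def by (auto simp: in_keys_iff)
  then show ?thesis using subspace_0[OF assms(1)] by simp
qed

lemma direct_sum_keys: "w \<in> direct_sum K A \<Longrightarrow> u \<in> Poly_Mapping.keys w \<Longrightarrow> u \<in> K"
  unfolding direct_sum_def by blast

lemma direct_sum_subspace:
  assumes "subspace A"
  shows "subspace (direct_sum K A)"
proof (rule subspaceI)
  show "0 \<in> direct_sum K A"
    using subspace_0[OF assms] by (simp add: direct_sum_def)
  show "v + w \<in> direct_sum K A" if "v \<in> direct_sum K A" "w \<in> direct_sum K A" for v w
    using that Poly_Mapping.keys_add[of v w] subspace_add[OF assms]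
    unfolding direct_sum_def by (auto simp: lookup_add)
  show "c *\<^sub>R v \<in> direct_sum K A" if "v \<in> direct_sum K A" for c v
    using that subspace_scale[OF assms]
    unfolding direct_sum_def by (auto simp: lookup_scaleR in_keys_iff)
qed

lemma single_in_direct_sum:
  assumes "subspace A" and "u \<in> K" and "x \<in> A"
  shows "Poly_Mapping.single u x \<in> direct_sum K A"
  using assms subspace_0[OF assms(1)]
  unfolding direct_sum_def by (auto simp: lookup_single when_def split: if_splits)

lemma single_linear:
  assumes "subspace A" and "u \<in> K"
  shows "linear_betw A (direct_sum K A) (Poly_Mapping.single u)"
  by (rule linear_betwI)
    (simp_all add: single_in_direct_sum[OF assms] single_add single_scaleR)

lemma sum_single_lookup:
  "(\<Sum>u\<in>Poly_Mapping.keys w. Poly_Mapping.single u (Poly_Mapping.lookup w u)) = w"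
  by (rule poly_mapping_eqI)
    (simp add: lookup_sum lookup_single when_def sum.delta in_keys_iff)

lemma linear_betw_direct_sum_eq_0:
  assumes "subspace A" and f: "linear_betw (direct_sum K A) B f"
    and z: "\<And>u x. u \<in> K \<Longrightarrow> x \<in> A \<Longrightarrow> f (Poly_Mapping.single u x) = 0"
    and w: "w \<in> direct_sum K A"
  shows "f w = 0"
proof -
  have "f w = (\<Sum>u\<in>Poly_Mapping.keys w. f (Poly_Mapping.single u (Poly_Mapping.lookup w u)))"
    by (subst (1) sum_single_lookup[symmetric],
        rule linear_betw_sum[OF f direct_sum_subspace[OF assms(1)]])
      (auto intro!: single_in_direct_sum[OF assms(1)] direct_sum_lookup[OF assms(1) w]
        direct_sum_keys[OF w])
  also have "\<dots> = 0"
    by (rule sum.neutral) (auto intro!: z direct_sum_lookup[OF assms(1) w] direct_sum_keys[OF w])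
  finally show ?thesis .
qed

lemma sum_map_single: "g 0 = 0 \<Longrightarrow> sum_map \<phi> g (Poly_Mapping.single u x) = Poly_Mapping.single (\<phi> u) (g x)"
  by (simp add: sum_map_def)

lemma sum_map_superset:
  assumes "g 0 = 0" and "finite S" and "Poly_Mapping.keys w \<subseteq> S"
  shows "sum_map \<phi> g w = (\<Sum>u\<in>S. Poly_Mapping.single (\<phi> u) (g (Poly_Mapping.lookup w u)))"
  unfolding sum_map_def
  by (rule sum.mono_neutral_left) (use assms in \<open>auto simp: in_keys_iff\<close>)

lemma sum_map_linear:
  assumes A: "subspace A" and B: "subspace B" and g: "linear_betw A B g" and \<phi>: "\<phi> \<in> K \<rightarrow> L"
  shows "linear_betw (direct_sum K A) (direct_sum L B) (sum_map \<phi> g)"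
proof (rule linear_betwI)
  note g0 = linear_betw_0[OF g A]
  note look = direct_sum_lookup[OF A]
  show "sum_map \<phi> g w \<in> direct_sum L B" if w: "w \<in> direct_sum K A" for w
    unfolding sum_map_def
    by (rule subspace_sum[OF direct_sum_subspace[OF B]])
      (use \<phi> in \<open>auto intro!: single_in_direct_sum[OF B] linear_betw_mem[OF g] look[OF w]
         dest: direct_sum_keys[OF w]\<close>)
  show "sum_map \<phi> g (v + w) = sum_map \<phi> g v + sum_map \<phi> g w"
    if vw: "v \<in> direct_sum K A" "w \<in> direct_sum K A" for v w
  proof -
    let ?S = "Poly_Mapping.keys v \<union> Poly_Mapping.keys w"
    have S: "finite ?S" "Poly_Mapping.keys v \<subseteq> ?S" "Poly_Mapping.keys w \<subseteq> ?S"
      "Poly_Mapping.keys (v + w) \<subseteq> ?S"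
      using Poly_Mapping.keys_add[of v w] by auto
    show ?thesis
      unfolding S(2-4)[THEN sum_map_superset[where g=g, OF g0 S(1)]]
      by (simp add: lookup_add linear_betw_add[OF g look[OF vw(1)] look[OF vw(2)]]
          single_add sum.distrib)
  qed
  show "sum_map \<phi> g (c *\<^sub>R w) = c *\<^sub>R sum_map \<phi> g w" if w: "w \<in> direct_sum K A" for c w
  proof -
    have "Poly_Mapping.keys (c *\<^sub>R w) \<subseteq> Poly_Mapping.keys w"
      by (auto simp: in_keys_iff lookup_scaleR)
    then show ?thesis
      using sum_map_superset[where g=g and w="c *\<^sub>R w" and S="Poly_Mapping.keys w", OF g0]
      by (simp add: lookup_scaleR linear_betw_scale[OF g look[OF w]] single_scaleR
          scaleR_right.sum sum_map_def[of \<phi> g w])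
  qed
qed

text \<open>The map \<open>\<psi>\<close> may send several keys to one, and \<open>sum_map \<psi> g'\<close> then adds their values; so
  functoriality rests on additivity of the outer map \<open>g\<close> on its carrier.\<close>

lemma sum_map_comp:
  assumes A: "subspace A" and B: "subspace B" and g: "linear_betw A B g"
    and g': "\<And>u. g' (Poly_Mapping.lookup w u) \<in> A"
  shows "sum_map \<phi> g (sum_map \<psi> g' w) = sum_map (\<lambda>u. \<phi> (\<psi> u)) (\<lambda>x. g (g' x)) w"
proof -
  have l: "linear_betw (direct_sum UNIV A) (direct_sum UNIV B) (sum_map \<phi> g)"
    by (rule sum_map_linear[OF A B g]) simp
  show ?thesis
    unfolding sum_map_def[of \<psi> g'] sum_map_def[of "\<lambda>u. \<phi> (\<psi> u)"]
    by (subst linear_betw_sum[OF l direct_sum_subspace[OF A]])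
      (simp_all add: single_in_direct_sum[OF A] g' sum_map_single[of g, OF linear_betw_0[OF g A]])
qed

lemma sum_map_cong:
  assumes "\<And>u. u \<in> Poly_Mapping.keys w \<Longrightarrow> \<phi> u = \<psi> u"
  shows "sum_map \<phi> g w = sum_map \<psi> g w"
  unfolding sum_map_def using assms by simp

lemma sum_map_id: "sum_map (\<lambda>u. u) (\<lambda>x. x) w = w"
  unfolding sum_map_def by (rule sum_single_lookup)

section \<open>Order-preserving maps and the standard simplices\<close>

definition order_maps :: "nat \<Rightarrow> nat \<Rightarrow> (nat \<Rightarrow> nat) set" where
  "order_maps a b = {\<theta> \<in> {..a} \<rightarrow> {..b}. mono_on {..a} \<theta>}"

lemma order_maps_le: "\<theta> \<in> order_maps a b \<Longrightarrow> x \<le> a \<Longrightarrow> \<theta> x \<le> b"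
  unfolding order_maps_def by auto

lemma order_maps_mono: "\<theta> \<in> order_maps a b \<Longrightarrow> x \<le> y \<Longrightarrow> y \<le> a \<Longrightarrow> \<theta> x \<le> \<theta> y"
  unfolding order_maps_def by (auto intro: mono_onD)

lemma level_std_simplex: "level (std_simplex m) l = order_maps l m \<inter> extensional {..l}"
  unfolding std_simplex_def order_maps_def by (auto simp: PiE_def)

lemma finite_level_std_simplex: "finite (level (std_simplex m) l)"
  by (rule finite_subset[of _ "{..l} \<rightarrow>\<^sub>E {..m}"]) (auto simp: std_simplex_def intro: finite_PiE)

lemma compose_order_maps:
  assumes "\<theta> \<in> order_maps b c" and "\<eta> \<in> order_maps a b"
  shows "compose {..a} \<theta> \<eta> \<in> level (std_simplex c) a"
  unfolding level_std_simplex order_maps_def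
  using order_maps_le[OF assms(1)] order_maps_le[OF assms(2)]
    order_maps_mono[OF assms(1)] order_maps_mono[OF assms(2)]
  by (auto simp: compose_def intro!: mono_onI)

lemma restrict_order_map: "\<theta> \<in> order_maps a b \<Longrightarrow> restrict \<theta> {..a} \<in> level (std_simplex b) a"
  unfolding level_std_simplex order_maps_def by (auto intro!: mono_onI dest: mono_onD)

lemma coface_order_map: "1 \<le> m \<Longrightarrow> coface i \<in> order_maps (m - 1) m"
  unfolding order_maps_def coface_def by (auto intro!: mono_onI)

lemma codegen_order_map: "j \<le> m \<Longrightarrow> codegen j \<in> order_maps (m + 1) m"
  unfolding order_maps_def codegen_def by (auto intro!: mono_onI)

text \<open>The cosimplicial identities hold for \<^const>\<open>coface\<close> and \<^const>\<open>codegen\<close> as maps on all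
  natural numbers.\<close>

lemma coface_coface: "i < j \<Longrightarrow> coface j (coface i a) = coface i (coface (j - 1) a)"
  unfolding coface_def by auto

lemma codegen_codegen: "i \<le> j \<Longrightarrow> codegen j (codegen i a) = codegen i (codegen (j + 1) a)"
  unfolding codegen_def by auto

lemma codegen_coface_less: "i < j \<Longrightarrow> codegen j (coface i a) = coface i (codegen (j - 1) a)"
  unfolding codegen_def coface_def by auto

lemma codegen_coface_same: "codegen j (coface j a) = a" "codegen j (coface (j + 1) a) = a"
  unfolding codegen_def coface_def by auto

lemma codegen_coface_greater: "j + 1 < i \<Longrightarrow> codegen j (coface i a) = coface (i - 1) (codegen j a)"
  unfolding codegen_def coface_def by auto

lemma coface_codegen: "a \<noteq> i \<Longrightarrow> coface i (codegen i a) = a"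
  unfolding codegen_def coface_def by auto

section \<open>Tensoring with a standard simplex\<close>

lemma level_tensor: "level (tensor U K) l = direct_sum (level K l) (level U l)"
  by (simp add: tensor_def)

lemma subspace_tensor: "simplicial_vector_space U \<Longrightarrow> subspace (level (tensor U K) l)"
  by (simp add: level_tensor direct_sum_subspace svs_subspace)

lemma face_tensor: "face (tensor U (std_simplex m)) l i =
    sum_map (\<lambda>u. compose {..l - 1} u (coface i)) (face U l i)"
  by (simp add: tensor_def std_simplex_def)

lemma degen_tensor: "degen (tensor U (std_simplex m)) l j =
    sum_map (\<lambda>u. compose {..l + 1} u (codegen j)) (degen U l j)"
  by (simp add: tensor_def std_simplex_def)

lemma face_tensor_mem:
  assumes U: "simplicial_vector_space U" and l: "1 \<le> l" "i \<le> l"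
    and w: "w \<in> level (tensor U (std_simplex m)) l"
  shows "face (tensor U (std_simplex m)) l i w \<in> level (tensor U (std_simplex m)) (l - 1)"
  unfolding face_tensor level_tensor
  by (rule linear_betw_mem[OF sum_map_linear[OF svs_subspace[OF U] svs_subspace[OF U]
          svs_face_linear[OF U l]] w[unfolded level_tensor]])
    (use coface_order_map[OF l(1)] in \<open>auto intro!: compose_order_maps simp: level_std_simplex[of m l]\<close>)

lemma degen_tensor_mem:
  assumes U: "simplicial_vector_space U" and j: "j \<le> l"
    and w: "w \<in> level (tensor U (std_simplex m)) l"
  shows "degen (tensor U (std_simplex m)) l j w \<in> level (tensor U (std_simplex m)) (l + 1)"
  unfolding degen_tensor level_tensor
  by (rule linear_betw_mem[OF sum_map_linear[OF svs_subspace[OF U] svs_subspace[OF U]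
          svs_degen_linear[OF U j]] w[unfolded level_tensor]])
    (use codegen_order_map[OF j] in \<open>auto intro!: compose_order_maps simp: level_std_simplex[of m l]\<close>)

lemma face_tensor_single:
  assumes U: "simplicial_vector_space U" and l: "1 \<le> l" "i \<le> l"
  shows "face (tensor U (std_simplex m)) l i (Poly_Mapping.single u x) =
    Poly_Mapping.single (compose {..l - 1} u (coface i)) (face U l i x)"
  unfolding face_tensor
  by (rule sum_map_single) (rule linear_betw_0[OF svs_face_linear[OF U l] svs_subspace[OF U]])

text \<open>The map \<open>U \<otimes> \<Delta>[p] \<rightarrow> U \<otimes> \<Delta>[m]\<close> induced by \<open>\<theta> : [p] \<rightarrow> [m]\<close>, in degree \<open>l\<close>.\<close>

definition push :: "nat \<Rightarrow> (nat \<Rightarrow> nat) \<Rightarrow> ((nat \<Rightarrow> nat) \<Rightarrow>\<^sub>0 'a::real_vector) \<Rightarrow> ((nat \<Rightarrow> nat) \<Rightarrow>\<^sub>0 'a)" where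
  "push l \<theta> = sum_map (\<lambda>u. compose {..l} \<theta> u) (\<lambda>v. v)"

lemma precomp_eq:
  "precomp U p \<theta> f = (\<lambda>l w. if w \<in> level (tensor U (std_simplex p)) l then f l (push l \<theta> w) else 0)"
  unfolding precomp_def push_def ..

lemma linear_betw_id: "linear_betw A A (\<lambda>x. x)"
  by (rule linear_betwI) auto

lemma push_linear:
  assumes U: "simplicial_vector_space U" and \<theta>: "\<theta> \<in> order_maps p m"
  shows "linear_betw (level (tensor U (std_simplex p)) l) (level (tensor U (std_simplex m)) l) (push l \<theta>)"
  unfolding level_tensor push_def
  by (rule sum_map_linear[OF svs_subspace[OF U] svs_subspace[OF U] linear_betw_id])
    (auto intro: compose_order_maps[OF \<theta>] simp: level_std_simplex[of p l])

lemma push_face: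
  assumes U: "simplicial_vector_space U" and l: "1 \<le> l" "i \<le> l"
    and w: "w \<in> level (tensor U (std_simplex p)) l"
  shows "push (l - 1) \<theta> (face (tensor U (std_simplex p)) l i w) =
    face (tensor U (std_simplex m)) l i (push l \<theta> w)"
proof -
  note sub = svs_subspace[OF U]
  have lk: "Poly_Mapping.lookup w u \<in> level U l" for u
    using direct_sum_lookup[OF sub w[unfolded level_tensor]] .
  have "coface i a \<le> l" if "a \<le> l - 1" for a
    using order_maps_le[OF coface_order_map[OF l(1)] that] .
  then have "compose {..l - 1} \<theta> (compose {..l - 1} u (coface i)) =
      compose {..l - 1} (compose {..l} \<theta> u) (coface i)" for u
    by (auto simp: compose_def fun_eq_iff)
  then show ?thesis
    unfolding push_def face_tensor
    by (simp add: sum_map_comp[where g="\<lambda>v. v" and g'="face U l i" and w=w,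
          OF sub sub linear_betw_id linear_betw_mem[OF svs_face_linear[OF U l] lk]]
        sum_map_comp[where g'="\<lambda>v. v", OF sub sub svs_face_linear[OF U l]] lk)
qed

lemma push_degen:
  assumes U: "simplicial_vector_space U" and j: "j \<le> l"
    and w: "w \<in> level (tensor U (std_simplex p)) l"
  shows "push (l + 1) \<theta> (degen (tensor U (std_simplex p)) l j w) =
    degen (tensor U (std_simplex m)) l j (push l \<theta> w)"
proof -
  note sub = svs_subspace[OF U]
  have lk: "Poly_Mapping.lookup w u \<in> level U l" for u
    using direct_sum_lookup[OF sub w[unfolded level_tensor]] .
  have "codegen j a \<le> l" if "a \<le> l + 1" for a
    using order_maps_le[OF codegen_order_map[OF j] that] .
  then have "compose {..l + 1} \<theta> (compose {..l + 1} u (codegen j)) =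
      compose {..l + 1} (compose {..l} \<theta> u) (codegen j)" for u
    by (auto simp: compose_def fun_eq_iff)
  then show ?thesis
    unfolding push_def degen_tensor
    by (simp add: sum_map_comp[where g="\<lambda>v. v" and g'="degen U l j" and w=w,
          OF sub sub linear_betw_id linear_betw_mem[OF svs_degen_linear[OF U j] lk]]
        sum_map_comp[where g'="\<lambda>v. v", OF sub sub svs_degen_linear[OF U j]] lk)
qed

lemma push_push:
  assumes U: "simplicial_vector_space U" and w: "w \<in> level (tensor U (std_simplex p)) l"
  shows "push l \<eta> (push l \<theta> w) = push l (\<lambda>a. \<eta> (\<theta> a)) w"
proof -
  note sub = svs_subspace[OF U]
  have lk: "Poly_Mapping.lookup w u \<in> level U l" for u
    using direct_sum_lookup[OF sub w[unfolded level_tensor]] .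
  have "compose {..l} \<eta> (compose {..l} \<theta> u) = compose {..l} (\<lambda>a. \<eta> (\<theta> a)) u" for u
    by (auto simp: compose_def fun_eq_iff)
  then show ?thesis
    unfolding push_def by (simp add: sum_map_comp[where g="\<lambda>v. v" and g'="\<lambda>v. v", OF sub sub linear_betw_id lk])
qed

lemma push_id:
  assumes w: "w \<in> level (tensor U (std_simplex p)) l"
  shows "push l (\<lambda>a. a) w = w"
proof -
  have "push l (\<lambda>a. a) w = sum_map (\<lambda>u. u) (\<lambda>v. v) w"
    unfolding push_def
    by (rule sum_map_cong)
      (use w in \<open>auto simp: compose_def level_tensor level_std_simplex extensional_def fun_eq_iff
        dest!: direct_sum_keys\<close>)
  then show ?thesis by (simp add: sum_map_id)
qed

lemma push_single: "push l \<theta> (Poly_Mapping.single u x) = Poly_Mapping.single (compose {..l} \<theta> u) x"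
  unfolding push_def by (simp add: sum_map_single)

section \<open>The internal hom is a simplicial vector space\<close>

lemma level_internal_hom: "level (internal_hom U V) m = SVec (tensor U (std_simplex m)) V"
  and face_internal_hom: "face (internal_hom U V) m i = precomp U (m - 1) (coface i)"
  and degen_internal_hom: "degen (internal_hom U V) m j = precomp U (m + 1) (codegen j)"
  by (simp_all add: internal_hom_def)

lemma SVecI:
  assumes "\<And>l. linear_betw (level X l) (level V l) (f l)"
    and "\<And>l x. x \<notin> level X l \<Longrightarrow> f l x = 0"
    and "\<And>l i x. 1 \<le> l \<Longrightarrow> i \<le> l \<Longrightarrow> x \<in> level X l \<Longrightarrow> f (l - 1) (face X l i x) = face V l i (f l x)"
    and "\<And>l j x. j \<le> l \<Longrightarrow> x \<in> level X l \<Longrightarrow> f (l + 1) (degen X l j x) = degen V l j (f l x)"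
  shows "f \<in> SVec X V"
  using assms unfolding SVec_def by simp

lemma SVec_linear: "f \<in> SVec X V \<Longrightarrow> linear_betw (level X l) (level V l) (f l)"
  unfolding SVec_def by simp

lemma SVec_off: "f \<in> SVec X V \<Longrightarrow> x \<notin> level X l \<Longrightarrow> f l x = 0"
  unfolding SVec_def by simp

lemma SVec_face:
  "f \<in> SVec X V \<Longrightarrow> 1 \<le> l \<Longrightarrow> i \<le> l \<Longrightarrow> x \<in> level X l \<Longrightarrow> f (l - 1) (face X l i x) = face V l i (f l x)"
  unfolding SVec_def by simp

lemma SVec_degen:
  "f \<in> SVec X V \<Longrightarrow> j \<le> l \<Longrightarrow> x \<in> level X l \<Longrightarrow> f (l + 1) (degen X l j x) = degen V l j (f l x)"
  unfolding SVec_def by simp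

lemma SVec_subspace:
  assumes V: "simplicial_vector_space V"
  shows "subspace (SVec X V)"
proof (rule subspaceI)
  note sub = svs_subspace[OF V]
  note F = svs_face_linear[OF V] and D = svs_degen_linear[OF V]
  show "0 \<in> SVec X V"
    using subspace_0[OF sub] linear_betw_0[OF F sub] linear_betw_0[OF D sub]
    by (intro SVecI linear_betwI) auto
  show "f + g \<in> SVec X V" if f: "f \<in> SVec X V" and g: "g \<in> SVec X V" for f g
  proof (intro SVecI linear_betwI)
    note lin = SVec_linear[OF f] SVec_linear[OF g]
    note mem = lin[THEN linear_betw_mem]
    show "(f + g) l x \<in> level V l" if "x \<in> level X l" for l x
      using mem that subspace_add[OF sub] by simp
    show "(f + g) l (x + y) = (f + g) l x + (f + g) l y" if "x \<in> level X l" "y \<in> level X l" for l x y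
      using that by (simp add: linear_betw_add[OF lin(1)] linear_betw_add[OF lin(2)])
    show "(f + g) l (c *\<^sub>R x) = c *\<^sub>R (f + g) l x" if "x \<in> level X l" for l c x
      using that by (simp add: linear_betw_scale[OF lin(1)] linear_betw_scale[OF lin(2)] scaleR_add_right)
    show "(f + g) l x = 0" if "x \<notin> level X l" for l x
      using that by (simp add: SVec_off[OF f] SVec_off[OF g])
    show "(f + g) (l - 1) (face X l i x) = face V l i ((f + g) l x)"
      if "1 \<le> l" "i \<le> l" "x \<in> level X l" for l i x
      using SVec_face[OF f that] SVec_face[OF g that] linear_betw_add[OF F[OF that(1,2)] mem[OF that(3)]]
      by simp
    show "(f + g) (l + 1) (degen X l j x) = degen V l j ((f + g) l x)"
      if "j \<le> l" "x \<in> level X l" for l j x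
      using SVec_degen[OF f that] SVec_degen[OF g that] linear_betw_add[OF D[OF that(1)] mem[OF that(2)]]
      by simp
  qed
  show "c *\<^sub>R f \<in> SVec X V" if f: "f \<in> SVec X V" for c f
  proof (intro SVecI linear_betwI)
    note lin = SVec_linear[OF f]
    note mem = lin[THEN linear_betw_mem]
    show "(c *\<^sub>R f) l x \<in> level V l" if "x \<in> level X l" for l x
      using mem that subspace_scale[OF sub] by (simp add: scaleR_fun_def)
    show "(c *\<^sub>R f) l (x + y) = (c *\<^sub>R f) l x + (c *\<^sub>R f) l y" if "x \<in> level X l" "y \<in> level X l" for l x y
      using that by (simp add: linear_betw_add[OF lin] scaleR_fun_def scaleR_add_right)
    show "(c *\<^sub>R f) l (d *\<^sub>R x) = d *\<^sub>R (c *\<^sub>R f) l x" if "x \<in> level X l" for l d x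
      using that by (simp add: linear_betw_scale[OF lin] scaleR_fun_def)
    show "(c *\<^sub>R f) l x = 0" if "x \<notin> level X l" for l x
      using that by (simp add: SVec_off[OF f] scaleR_fun_def)
    show "(c *\<^sub>R f) (l - 1) (face X l i x) = face V l i ((c *\<^sub>R f) l x)"
      if "1 \<le> l" "i \<le> l" "x \<in> level X l" for l i x
      using SVec_face[OF f that] linear_betw_scale[OF F[OF that(1,2)] mem[OF that(3)]]
      by (simp add: scaleR_fun_def)
    show "(c *\<^sub>R f) (l + 1) (degen X l j x) = degen V l j ((c *\<^sub>R f) l x)"
      if "j \<le> l" "x \<in> level X l" for l j x
      using SVec_degen[OF f that] linear_betw_scale[OF D[OF that(1)] mem[OF that(2)]]
      by (simp add: scaleR_fun_def)
  qed
qed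

lemma precomp_in_SVec:
  assumes U: "simplicial_vector_space U" and \<theta>: "\<theta> \<in> order_maps p m"
    and f: "f \<in> SVec (tensor U (std_simplex m)) V"
  shows "precomp U p \<theta> f \<in> SVec (tensor U (std_simplex p)) V"
proof (rule SVecI)
  let ?X = "tensor U (std_simplex p)"
  note P = push_linear[OF U \<theta>] and L = SVec_linear[OF f] and S = subspace_tensor[OF U]
  note mem = linear_betw_mem[OF P]
  show "linear_betw (level ?X l) (level V l) (precomp U p \<theta> f l)" for l
    by (rule linear_betwI)
      (simp_all add: precomp_eq subspace_add[OF S] subspace_scale[OF S] linear_betw_mem[OF L] mem
        linear_betw_add[OF P] linear_betw_add[OF L] linear_betw_scale[OF P] linear_betw_scale[OF L])
  show "precomp U p \<theta> f l x = 0" if "x \<notin> level ?X l" for l x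
    using that by (simp add: precomp_eq)
  show "precomp U p \<theta> f (l - 1) (face ?X l i x) = face V l i (precomp U p \<theta> f l x)"
    if "1 \<le> l" "i \<le> l" "x \<in> level ?X l" for l i x
    using face_tensor_mem[OF U that] that(3) push_face[OF U that, of \<theta> m]
      SVec_face[OF f that(1,2) mem[OF that(3)]]
    by (simp add: precomp_eq)
  show "precomp U p \<theta> f (l + 1) (degen ?X l j x) = degen V l j (precomp U p \<theta> f l x)"
    if "j \<le> l" "x \<in> level ?X l" for l j x
    using degen_tensor_mem[OF U that] that(2) push_degen[OF U that, of \<theta> m]
      SVec_degen[OF f that(1) mem[OF that(2)]]
    by (simp add: precomp_eq)
qed

lemma precomp_linear:
  assumes U: "simplicial_vector_space U" and \<theta>: "\<theta> \<in> order_maps p m"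
  shows "linear_betw (SVec (tensor U (std_simplex m)) V) (SVec (tensor U (std_simplex p)) V)
    (precomp U p \<theta>)"
  by (rule linear_betwI, rule precomp_in_SVec[OF U \<theta>], assumption)
    (auto simp: precomp_eq scaleR_fun_def fun_eq_iff)

lemma precomp_precomp:
  assumes U: "simplicial_vector_space U" and \<theta>: "\<theta> \<in> order_maps p m"
  shows "precomp U p \<theta> (precomp U m \<eta> f) = precomp U p (\<lambda>a. \<eta> (\<theta> a)) f"
  using linear_betw_mem[OF push_linear[OF U \<theta>]] push_push[OF U, of _ p _ \<eta> \<theta>]
  by (auto simp: precomp_eq fun_eq_iff)

lemma precomp_id: "f \<in> SVec (tensor U (std_simplex p)) V \<Longrightarrow> precomp U p (\<lambda>a. a) f = f"
  by (auto simp: precomp_eq fun_eq_iff push_id SVec_off)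

lemma internal_hom_simplicial_vector_space:
  assumes U: "simplicial_vector_space U" and V: "simplicial_vector_space V"
  shows "simplicial_vector_space (internal_hom U V)"
proof -
  note pp = precomp_precomp[OF U]
  note co = coface_order_map and cg = codegen_order_map
  have "simplicial_set (internal_hom U V)"
    unfolding simplicial_set_def level_internal_hom face_internal_hom degen_internal_hom
  proof (intro conjI allI impI ballI)
    fix m i :: nat assume "1 \<le> m" "i \<le> m"
    then show "precomp U (m - 1) (coface i)
        \<in> SVec (tensor U (std_simplex m)) V \<rightarrow> SVec (tensor U (std_simplex (m - 1))) V"
      using precomp_in_SVec[OF U co] by blast
  next
    fix m j :: nat assume "j \<le> m"
    then show "precomp U (m + 1) (codegen j)
        \<in> SVec (tensor U (std_simplex m)) V \<rightarrow> SVec (tensor U (std_simplex (m + 1))) V"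
      using precomp_in_SVec[OF U cg] by blast
  next
    fix m i j f assume "2 \<le> (m::nat)" "i < (j::nat)"
    then show "precomp U (m - 1 - 1) (coface i) (precomp U (m - 1) (coface j) f) =
        precomp U (m - 1 - 1) (coface (j - 1)) (precomp U (m - 1) (coface i) f)"
      using co[of "m - 1" i] co[of "m - 1" "j - 1"]
      by (subst (1 2) pp) (simp_all add: coface_coface[of i j])
  next
    fix m i j f assume "j \<le> (m::nat)" "i \<le> (j::nat)"
    then show "precomp U (m + 1 + 1) (codegen i) (precomp U (m + 1) (codegen j) f) =
        precomp U (m + 1 + 1) (codegen (j + 1)) (precomp U (m + 1) (codegen i) f)"
      using cg[of i "m + 1"] cg[of "j + 1" "m + 1"]
      by (simp add: pp codegen_codegen[of i j])
  next
    fix m i j f assume *: "1 \<le> (m::nat)" "j \<le> (m::nat)" "i < (j::nat)"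
    have "precomp U (m + 1 - 1) (coface i) (precomp U (m + 1) (codegen j) f) =
        precomp U m (\<lambda>a. codegen j (coface i a)) f"
      using pp[OF co[of "m + 1" i], of "codegen j" f] by simp
    moreover have "precomp U (m - 1 + 1) (codegen (j - 1)) (precomp U (m - 1) (coface i) f) =
        precomp U m (\<lambda>a. coface i (codegen (j - 1) a)) f"
      using pp[OF cg[of "j - 1" "m - 1"], of "coface i" f] * by simp
    ultimately show "precomp U (m + 1 - 1) (coface i) (precomp U (m + 1) (codegen j) f) =
        precomp U (m - 1 + 1) (codegen (j - 1)) (precomp U (m - 1) (coface i) f)"
      using * by (simp only: codegen_coface_less)
  next
    fix m i j f assume *: "1 \<le> (m::nat)" "j \<le> (m::nat)" "j + 1 < (i::nat)"
    have "precomp U (m + 1 - 1) (coface i) (precomp U (m + 1) (codegen j) f) =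
        precomp U m (\<lambda>a. codegen j (coface i a)) f"
      using pp[OF co[of "m + 1" i], of "codegen j" f] by simp
    moreover have "precomp U (m - 1 + 1) (codegen j) (precomp U (m - 1) (coface (i - 1)) f) =
        precomp U m (\<lambda>a. coface (i - 1) (codegen j a)) f" if "j \<le> m - 1"
      using pp[OF cg[of j "m - 1"], of "coface (i - 1)" f] * that by simp
    moreover assume "i \<le> m + 1"
    ultimately show "precomp U (m + 1 - 1) (coface i) (precomp U (m + 1) (codegen j) f) =
        precomp U (m - 1 + 1) (codegen j) (precomp U (m - 1) (coface (i - 1)) f)"
      using * by (simp only: codegen_coface_greater)
  next
    fix m j f assume *: "j \<le> (m::nat)" "f \<in> SVec (tensor U (std_simplex m)) V"
    show "precomp U (m + 1 - 1) (coface j) (precomp U (m + 1) (codegen j) f) = f"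
      "precomp U (m + 1 - 1) (coface (j + 1)) (precomp U (m + 1) (codegen j) f) = f"
      using pp[OF co[of "m + 1" j], of "codegen j" f] pp[OF co[of "m + 1" "j + 1"], of "codegen j" f]
        codegen_coface_same[of j] precomp_id[OF *(2)]
      by simp_all
  qed
  then show ?thesis
    unfolding simplicial_vector_space_def level_internal_hom face_internal_hom degen_internal_hom
    using SVec_subspace[OF V] precomp_linear[OF U co] precomp_linear[OF U cg] by blast
qed

section \<open>Vanishing of morphisms\<close>

text \<open>The faces of a value of \<open>f\<close> are values of \<open>f\<close> one degree lower. From degree \<open>N\<close> on a simplex
  of \<open>V\<close> is determined by its faces, so vanishing propagates upwards from the degrees below \<open>N\<close>.
  This takes care of the values on simplices \<open>x\<^sup>u\<close> with \<open>u\<close> degenerate and \<open>x\<close> not, which are not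
  reached by degeneracies.\<close>

lemma SVec_eq_0_if_low_degrees_eq_0:
  assumes X: "\<And>l i x. 1 \<le> l \<Longrightarrow> i \<le> l \<Longrightarrow> x \<in> level X l \<Longrightarrow> face X l i x \<in> level X (l - 1)"
    and V: "\<And>l y. N \<le> l \<Longrightarrow> y \<in> level V l \<Longrightarrow> (\<And>i. i \<le> l \<Longrightarrow> face V l i y = 0) \<Longrightarrow> y = 0"
    and N: "1 \<le> N" and f: "f \<in> SVec X V"
    and low: "\<And>l x. l < N \<Longrightarrow> x \<in> level X l \<Longrightarrow> f l x = 0"
  shows "f = 0"
proof -
  have "f l x = 0" if "x \<in> level X l" for l x
    using that
  proof (induction l arbitrary: x rule: less_induct)
    case (less l)
    show ?case
    proof (cases "l < N")
      case True
      then show ?thesis using low less.prems by blast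
    next
      case False
      then have l: "N \<le> l" "1 \<le> l" using N by auto
      show ?thesis
      proof (rule V[OF l(1)])
        show "f l x \<in> level V l" using linear_betw_mem[OF SVec_linear[OF f] less.prems] .
        show "face V l i (f l x) = 0" if "i \<le> l" for i
          using SVec_face[OF f l(2) that less.prems] less.IH[OF _ X[OF l(2) that less.prems]] l(2)
          by simp
      qed
    qed
  qed
  then show ?thesis using SVec_off[OF f] by (auto simp: fun_eq_iff)
qed

lemma SVec_eval_single_linear:
  assumes U: "simplicial_vector_space U" and f: "f \<in> SVec (tensor U K) V" and u: "u \<in> level K l"
  shows "linear_betw (level U l) (level V l) (\<lambda>x. f l (Poly_Mapping.single u x))"
  by (rule linear_betw_comp[OF single_linear[OF svs_subspace[OF U] u]
        SVec_linear[OF f, unfolded level_tensor]])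

text \<open>A simplex of \<open>\<Delta>[m]\<close> in degree below \<open>m\<close> whose image contains \<open>[m] - {k}\<close> is the coface
  \<open>\<delta>\<^sup>k\<close>: counting forces the degree to be \<open>m - 1\<close> and the map to be injective with image exactly
  \<open>[m] - {k}\<close>.\<close>

lemma order_map_onto_coface:
  assumes u: "u \<in> level (std_simplex m) l" and l: "l < m" and k: "k \<le> m"
    and onto: "{..m} - {k} \<subseteq> u ` {..l}"
  shows "l = m - 1" and "u = restrict (coface k) {..m - 1}"
proof -
  have c: "card ({..m} - {k}) = m" using k by simp
  have "m \<le> card (u ` {..l})" using card_mono[OF _ onto] c by simp
  moreover have "card (u ` {..l}) \<le> l + 1" using card_image_le[of "{..l}" u] by simp
  ultimately have cu: "card (u ` {..l}) = m" and lm: "m = l + 1" using l by auto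
  show "l = m - 1" using lm by simp
  have im: "u ` {..l} = {..m} - {k}" using card_subset_eq[OF _ onto] cu c by simp
  have inj: "inj_on u {..l}" by (rule eq_card_imp_inj_on) (use cu lm in auto)
  have uo: "u \<in> order_maps l m" and ue: "u \<in> extensional {..l}"
    using u by (auto simp: level_std_simplex)
  \<comment> \<open>Two increasing injections of \<open>{..l}\<close> with the same image agree.\<close>
  have im': "coface k ` {..l} = {..m} - {k}"
  proof
    show "coface k ` {..l} \<subseteq> {..m} - {k}" using lm by (auto simp: coface_def)
    show "{..m} - {k} \<subseteq> coface k ` {..l}"
    proof
      fix a assume a: "a \<in> {..m} - {k}"
      then have "a = coface k (codegen k a)" using coface_codegen by simp
      moreover have "codegen k a \<le> l" using a lm k by (auto simp: codegen_def)
      ultimately show "a \<in> coface k ` {..l}" by blast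
    qed
  qed
  have inj': "inj_on (coface k) {..l}" by (auto simp: inj_on_def coface_def split: if_splits)
  have "map u [0..<Suc l] = map (coface k) [0..<Suc l]"
  proof (rule sorted_distinct_set_unique)
    have s: "set [0..<Suc l] = {..l}" by auto
    show "sorted (map u [0..<Suc l])"
      using order_maps_mono[OF uo] by (auto simp: sorted_iff_nth_mono simp del: upt_Suc)
    show "sorted (map (coface k) [0..<Suc l])"
      by (auto simp: sorted_iff_nth_mono coface_def simp del: upt_Suc)
    show "distinct (map u [0..<Suc l])" "distinct (map (coface k) [0..<Suc l])"
      using inj inj' by (simp_all only: distinct_map distinct_upt s simp_thms)
    show "set (map u [0..<Suc l]) = set (map (coface k) [0..<Suc l])"
      by (simp only: set_map s im im')
  qed
  then have "u a = coface k a" if "a \<le> l" for a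
    using that by (simp del: upt_Suc add: map_eq_conv)
  then show "u = restrict (coface k) {..m - 1}"
    using ue lm by (auto simp: fun_eq_iff extensional_def)
qed

text \<open>If \<open>u\<close> misses \<open>i\<close>, then \<open>u = \<delta>\<^sup>i \<circ> (\<sigma>\<^sup>i \<circ> u)\<close>, so a morphism on \<open>U \<otimes> \<Delta>[m]\<close> takes at \<open>x\<^sup>u\<close> a value
  of its \<open>i\<close>-th face.\<close>

lemma precomp_coface_single:
  assumes U: "simplicial_vector_space U" and u: "u \<in> level (std_simplex m) l" and x: "x \<in> level U l"
    and i: "i \<le> m" "i \<notin> u ` {..l}"
  obtains w where "precomp U (m - 1) (coface i) f l w = f l (Poly_Mapping.single u x)"
proof -
  define u' where "u' = compose {..l} (codegen i) u"
  have uo: "u \<in> order_maps l m" and ue: "u \<in> extensional {..l}"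
    using u by (auto simp: level_std_simplex)
  have ne: "u a \<noteq> i" if "a \<le> l" for a using i(2) that by auto
  have le: "u a \<le> m" if "a \<le> l" for a using order_maps_le[OF uo that] .
  have "codegen i (u a) \<le> m - 1" if "a \<le> l" for a
    using ne[OF that] le[OF that] i(1) by (auto simp: codegen_def)
  moreover have "codegen i (u a) \<le> codegen i (u b)" if "a \<le> b" "b \<le> l" for a b
    using order_maps_mono[OF uo that] by (auto simp: codegen_def)
  ultimately have u': "u' \<in> level (std_simplex (m - 1)) l"
    unfolding u'_def level_std_simplex order_maps_def by (auto simp: compose_def intro!: mono_onI)
  have u_eq: "compose {..l} (coface i) u' = u"
    using ue ne by (auto simp: u'_def compose_def fun_eq_iff extensional_def coface_codegen)
  have w: "Poly_Mapping.single u' x \<in> level (tensor U (std_simplex (m - 1))) l"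
    unfolding level_tensor by (rule single_in_direct_sum[OF svs_subspace[OF U] u' x])
  show thesis
    by (rule that[of "Poly_Mapping.single u' x"]) (use w in \<open>simp add: precomp_eq push_single u_eq\<close>)
qed

text \<open>A morphism \<open>f\<close> in the kernel of the horn projection vanishes on every simplex of \<open>\<Delta>[m]\<close> whose
  image misses some \<open>i \<noteq> k\<close>. Below degree \<open>m\<close> this leaves only the coface \<open>\<delta>\<^sup>k\<close>. The values of \<open>f\<close>
  at the top simplex \<open>id\<close> have vanishing faces except perhaps the \<open>k\<close>-th, so they are zero by the
  hypothesis on \<open>V\<close>; and every value at \<open>\<delta>\<^sup>k\<close> is the \<open>k\<close>-th face of a value at \<open>id\<close>,
  since \<open>d\<^sub>k : U\<^sub>m \<rightarrow> U\<^sub>m\<^sub>-\<^sub>1\<close> is onto. From degree \<open>m\<close> on, \<open>f\<close> vanishes because it does so below.\<close>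

lemma internal_hom_trivial_kernel:
  assumes U: "simplicial_vector_space U"
    and V: "\<And>l j y. m \<le> l \<Longrightarrow> j \<le> l \<Longrightarrow> y \<in> level V l \<Longrightarrow>
      (\<And>i. i \<le> l \<Longrightarrow> i \<noteq> j \<Longrightarrow> face V l i y = 0) \<Longrightarrow> y = 0"
    and svsV: "simplicial_vector_space V"
    and m: "1 \<le> m" and k: "k \<le> m" and f: "f \<in> level (internal_hom U V) m"
    and ker: "\<And>i. i \<le> m \<Longrightarrow> i \<noteq> k \<Longrightarrow> face (internal_hom U V) m i f = 0"
  shows "f = 0"
proof -
  let ?\<Delta> = "std_simplex m"
  note f = f[unfolded level_internal_hom] and sub = svs_subspace[OF U]
  have miss: "f l (Poly_Mapping.single u x) = 0"
    if u: "u \<in> level ?\<Delta> l" and x: "x \<in> level U l" and i: "i \<le> m" "i \<noteq> k" "i \<notin> u ` {..l}"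
    for l u x i
  proof -
    obtain w where "precomp U (m - 1) (coface i) f l w = f l (Poly_Mapping.single u x)"
      using precomp_coface_single[OF U u x i(1,3), of f] .
    then show ?thesis using ker[OF i(1,2)] by (simp add: face_internal_hom)
  qed
  define idm where "idm = restrict (\<lambda>a. a) {..m}"
  have idm: "idm \<in> level ?\<Delta> m"
    unfolding idm_def by (rule restrict_order_map) (auto simp: order_maps_def intro!: mono_onI)
  have face_idm: "compose {..m - 1} idm (coface i) = restrict (coface i) {..m - 1}" for i
    using order_maps_le[OF coface_order_map[OF m]] by (auto simp: idm_def compose_def fun_eq_iff)
  have value_face: "face V m i (f m (Poly_Mapping.single idm y)) =
      f (m - 1) (Poly_Mapping.single (restrict (coface i) {..m - 1}) (face U m i y))"
    if "i \<le> m" "y \<in> level U m" for i y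
    using SVec_face[OF f m that(1), of "Poly_Mapping.single idm y"]
      single_in_direct_sum[OF sub idm that(2)]
    unfolding level_tensor face_tensor_single[OF U m that(1)] face_idm by metis
  have at_idm: "f m (Poly_Mapping.single idm y) = 0" if y: "y \<in> level U m" for y
  proof (rule V[OF order_refl k])
    show "f m (Poly_Mapping.single idm y) \<in> level V m"
      using linear_betw_mem[OF SVec_eval_single_linear[OF U f idm] y] .
    show "face V m i (f m (Poly_Mapping.single idm y)) = 0" if i: "i \<le> m" "i \<noteq> k" for i
      unfolding value_face[OF i(1) y]
    proof (rule miss[OF _ _ i])
      show "restrict (coface i) {..m - 1} \<in> level ?\<Delta> (m - 1)"
        by (rule restrict_order_map[OF coface_order_map[OF m]])
      show "face U m i y \<in> level U (m - 1)"
        using linear_betw_mem[OF svs_face_linear[OF U m i(1)] y] .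
      show "i \<notin> restrict (coface i) {..m - 1} ` {..m - 1}"
        by (auto simp: coface_def)
    qed
  qed
  have at_coface: "f (m - 1) (Poly_Mapping.single (restrict (coface k) {..m - 1}) x) = 0"
    if x: "x \<in> level U (m - 1)" for x
  proof -
    obtain y where y: "y \<in> level U m" "face U m k y = x"
    proof -
      \<comment> \<open>\<open>d\<^sub>k s\<^sub>j = id\<close> for \<open>j = k\<close> and for \<open>j = k - 1\<close>; the former is available unless \<open>k = m\<close>.\<close>
      define j where "j = (if k = m then k - 1 else k)"
      have j: "j \<le> m - 1" "k = j \<or> k = j + 1" using k m by (auto simp: j_def)
      have "face U m k (degen U (m - 1) j x) = x"
        using j(2) svs_face_degen_same[OF U j(1) x] m by auto
      then show thesis
        using that linear_betw_mem[OF svs_degen_linear[OF U j(1)] x] m by simp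
    qed
    have "face V m k 0 = 0"
      using linear_betw_0[OF svs_face_linear[OF svsV m k] svs_subspace[OF svsV]] .
    then show ?thesis using value_face[OF k y(1)] at_idm[OF y(1)] y(2) by simp
  qed
  show ?thesis
  proof (rule SVec_eq_0_if_low_degrees_eq_0[OF _ _ m f])
    show "face (tensor U ?\<Delta>) l i x \<in> level (tensor U ?\<Delta>) (l - 1)"
      if "1 \<le> l" "i \<le> l" "x \<in> level (tensor U ?\<Delta>) l" for l i x
      using face_tensor_mem[OF U that] .
    show "y = 0" if "m \<le> l" "y \<in> level V l" "\<And>i. i \<le> l \<Longrightarrow> face V l i y = 0" for l y
      using V[OF that(1) le0 that(2)] that(3) by blast
    show "f l w = 0" if l: "l < m" and w: "w \<in> level (tensor U ?\<Delta>) l" for l w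
    proof (rule linear_betw_direct_sum_eq_0[OF sub SVec_linear[OF f, unfolded level_tensor] _
          w[unfolded level_tensor]])
      fix u x assume u: "u \<in> level ?\<Delta> l" and x: "x \<in> level U l"
      show "f l (Poly_Mapping.single u x) = 0"
      proof (cases "{..m} - {k} \<subseteq> u ` {..l}")
        case True
        then show ?thesis
          using order_map_onto_coface[OF u l k True] at_coface x by simp
      next
        case False
        then show ?thesis using miss[OF u x] by blast
      qed
    qed
  qed
qed

text \<open>A morphism is determined by its values in the finitely many degrees below \<open>N\<close>, hence by the
  coordinates of its values at \<open>b\<^sup>u\<close> for \<open>b\<close> in a finite spanning set of \<open>U\<^sub>l\<close> and \<open>u\<close> in the
  finite set \<open>\<Delta>[m]\<^sub>l\<close>, \<open>l < N\<close>. These are finitely many linear functionals that separate points.\<close>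

lemma internal_hom_levelwise_finite_dim:
  assumes U: "simplicial_vector_space U" and Uf: "levelwise_finite_dim U"
    and V: "simplicial_vector_space V" and Vf: "levelwise_finite_dim V"
    and N: "1 \<le> N"
    and Vdet: "\<And>l y. N \<le> l \<Longrightarrow> y \<in> level V l \<Longrightarrow> (\<And>i. i \<le> l \<Longrightarrow> face V l i y = 0) \<Longrightarrow> y = 0"
  shows "levelwise_finite_dim (internal_hom U V)"
  unfolding levelwise_finite_dim_def level_internal_hom
proof
  fix m
  let ?\<Delta> = "std_simplex m"
  obtain B where B: "\<And>l. finite (B l)" "\<And>l. span (B l) = level U l"
    using Uf unfolding levelwise_finite_dim_def by metis
  have "\<exists>C (r :: 'b \<Rightarrow> 'b \<Rightarrow> real). finite C \<and> (\<forall>c\<in>C. linear_betw (level V l) UNIV (r c)) \<and>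
      (\<forall>y\<in>level V l. (\<forall>c\<in>C. r c y = 0) \<longrightarrow> y = 0)" for l
  proof -
    obtain B' where B': "finite B'" "span B' = level V l"
      using Vf unfolding levelwise_finite_dim_def by blast
    show ?thesis using finite_coordinates[OF B'(1)] unfolding B'(2) .
  qed
  then obtain C and r :: "nat \<Rightarrow> 'b \<Rightarrow> 'b \<Rightarrow> real" where C: "\<And>l. finite (C l)"
    and r: "\<And>l c. c \<in> C l \<Longrightarrow> linear_betw (level V l) UNIV (r l c)"
    and sep: "\<And>l y. y \<in> level V l \<Longrightarrow> (\<And>c. c \<in> C l \<Longrightarrow> r l c y = 0) \<Longrightarrow> y = 0"
    by metis
  let ?I = "SIGMA l:{..<N}. level ?\<Delta> l \<times> B l \<times> C l"
  let ?\<phi> = "\<lambda>(l, u, b, c) f. r l c (f l (Poly_Mapping.single u b))"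
  have mem: "f l (Poly_Mapping.single u b) \<in> level V l"
    if "f \<in> SVec (tensor U ?\<Delta>) V" "u \<in> level ?\<Delta> l" "b \<in> B l" for f l u b
    using linear_betw_mem[OF SVec_eval_single_linear[OF U that(1,2)], of b] span_base[OF that(3)] B(2)
    by simp
  show "\<exists>D. finite D \<and> span D = SVec (tensor U ?\<Delta>) V"
  proof (rule finite_span_if_finite_separating_functionals[of ?I _ ?\<phi>])
    show "finite ?I"
      by (intro finite_SigmaI finite_cartesian_product finite_level_std_simplex B C) simp
    show "subspace (SVec (tensor U ?\<Delta>) V)" by (rule SVec_subspace[OF V])
    show "linear_betw (SVec (tensor U ?\<Delta>) V) UNIV (?\<phi> i)" if "i \<in> ?I" for i
    proof -
      obtain l u b c where i: "i = (l, u, b, c)" by (cases i)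
      then have *: "u \<in> level ?\<Delta> l" "b \<in> B l" "c \<in> C l" using that by auto
      show ?thesis
        unfolding i
        by (rule linear_betwI)
          (simp_all add: linear_betw_add[OF r[OF *(3)]] linear_betw_scale[OF r[OF *(3)]]
            mem *(1,2) scaleR_fun_def)
    qed
    show "f = 0" if f: "f \<in> SVec (tensor U ?\<Delta>) V" and z: "\<And>i. i \<in> ?I \<Longrightarrow> ?\<phi> i f = 0" for f
    proof (rule SVec_eq_0_if_low_degrees_eq_0[OF face_tensor_mem[OF U] Vdet N f])
      show "f l w = 0" if l: "l < N" and w: "w \<in> level (tensor U ?\<Delta>) l" for l w
      proof (rule linear_betw_direct_sum_eq_0[OF svs_subspace[OF U]
            SVec_linear[OF f, unfolded level_tensor] _ w[unfolded level_tensor]])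
        fix u x assume u: "u \<in> level ?\<Delta> l" and x: "x \<in> level U l"
        show "f l (Poly_Mapping.single u x) = 0"
        proof (rule linear_betw_eq_0_on_span[where f="\<lambda>x. f l (Poly_Mapping.single u x)"])
          show "linear_betw (span (B l)) (level V l) (\<lambda>x. f l (Poly_Mapping.single u x))"
            using SVec_eval_single_linear[OF U f u] B(2) by simp
          show "x \<in> span (B l)" using x B(2) by simp
          show "f l (Poly_Mapping.single u b) = 0" if b: "b \<in> B l" for b
          proof (rule sep[OF mem[OF f u b]])
            show "r l c (f l (Poly_Mapping.single u b)) = 0" if c: "c \<in> C l" for c
              using z[of "(l, u, b, c)"] l u b c by simp
          qed
        qed
      qed
    qed
  qed
qed

theorem theorem3p19:
  fixes U :: "'a::real_vector simplicial"
    and V :: "'b::real_vector simplicial"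
    and n :: enat
  assumes "simplicial_vector_space U" and "levelwise_finite_dim U"
    and "VS_groupoid n V" and "levelwise_finite_dim V"
  shows "VS_groupoid n (internal_hom U V) \<and>
         (n \<noteq> \<infinity> \<longrightarrow> levelwise_finite_dim (internal_hom U V))"
proof
  note U = assms(1)
  have V: "simplicial_vector_space V"
    using assms(3) unfolding VS_groupoid_def by (rule conjunct1)
  have ker: "y = 0" if "n + 1 \<le> enat l" "j \<le> l" "y \<in> level V l"
    "\<And>i. i \<le> l \<Longrightarrow> i \<noteq> j \<Longrightarrow> face V l i y = 0" for l j y
    using VS_groupoid_iff_trivial_kernels[THEN iffD1, OF assms(3), THEN conjunct2, rule_format, OF that(1-3)]
      that(4) by simp
  show "VS_groupoid n (internal_hom U V)"
    unfolding VS_groupoid_iff_trivial_kernels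
  proof (intro conjI allI impI internal_hom_simplicial_vector_space[OF U V])
    fix m k f
    assume m: "n + 1 \<le> enat m" and k: "k \<le> m" and f: "f \<in> level (internal_hom U V) m"
      and z: "\<forall>i\<le>m. i \<noteq> k \<longrightarrow> face (internal_hom U V) m i f = 0"
    have m1: "1 \<le> m" using m by (cases n) (auto simp: one_enat_def)
    have above: "n + 1 \<le> enat l" if "m \<le> l" for l
      using m that by (meson enat_ord_simps(1) order_trans)
    show "f = 0"
    proof (rule internal_hom_trivial_kernel[OF U _ V m1 k f])
      show "y = 0" if "m \<le> l" "j \<le> l" "y \<in> level V l"
        "\<And>i. i \<le> l \<Longrightarrow> i \<noteq> j \<Longrightarrow> face V l i y = 0" for l j y
        using ker[OF above[OF that(1)] that(2-4)] .
      show "face (internal_hom U V) m i f = 0" if "i \<le> m" "i \<noteq> k" for i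
        using z that by simp
    qed
  qed
  show "n \<noteq> \<infinity> \<longrightarrow> levelwise_finite_dim (internal_hom U V)"
  proof
    assume "n \<noteq> \<infinity>"
    then obtain d where d: "n = enat d" by auto
    have "y = 0" if "d + 1 \<le> l" "y \<in> level V l" "\<And>i. i \<le> l \<Longrightarrow> face V l i y = 0" for l y
      using ker[of l 0 y] that by (auto simp: d one_enat_def)
    then show "levelwise_finite_dim (internal_hom U V)"
      using internal_hom_levelwise_finite_dim[OF U assms(2) V assms(4), of "d + 1"] by simp
  qed
qed

end
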